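(* A locally semicomplete digraph $D$ is chordal if and only if $S(D)$ is chordal and $D$ contains as an induced subdigraph neither a directed cycle consisting of non-symmetric arcs nor any of the digraphs $F_a, F_b, F_c, F_d$ described in the context.
   Context: Digraphs are finite, have no loops and no multiple arcs, but may contain digons; an arc lying in a digon is called symmetric, otherwise non-symmetric. $N^-(v)$ / $N^+(v)$ denote the sets of in-/out-neighbours of $v$. A vertex $v$ is di-simplicial if for every $u \in N^-(v)$ and $w \in N^+(v)$ with $u \neq w$, $uw$ is an arc. A digraph is chordal if every induced subdigraph contains a di-simplicial vertex. $S(D)$ is the spanning subdigraph of $D$ consisting of all symmetric arcs of $D$. A digraph is semicomplete if between any two distinct vertices there is at least one arc; $D$ is locally semicomplete if for every vertex $v$, both $N^-(v)$ and $N^+(v)$ induce semicomplete subdigraphs. The digraphs $F_a,F_b,F_c$ have vertex set $\{1,2,3,4\}$ with symmetric arcs $1\leftrightarrow 3$ and $2 \leftrightarrow 4$, plus: $F_a$: non-symmetric arcs $1\to2$, $2\to3$, $4\to1$ and symmetric arc $3\leftrightarrow4$; $F_b$: non-symmetric arcs $1\to2$, $2\to3$, $3\to4$, $4\to1$; $F_c$: non-symmetric arcs $1\to2$, $2\to3$, $4\to3$, $4\to1$. $F_d$ is the directed 3-cycle $1\to2\to3\to1$ with all arcs non-symmetric. *)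

theory Defs
  imports Main
begin

definition digraph :: "'a set \<Rightarrow> ('a \<times> 'a) set \<Rightarrow> bool" where
  "digraph V A \<longleftrightarrow> finite V \<and> A \<subseteq> V \<times> V \<and> (\<forall>x. (x, x) \<notin> A)"

definition in_nbrs :: "('a \<times> 'a) set \<Rightarrow> 'a \<Rightarrow> 'a set" where
  "in_nbrs A v = {u. (u, v) \<in> A}"

definition out_nbrs :: "('a \<times> 'a) set \<Rightarrow> 'a \<Rightarrow> 'a set" where
  "out_nbrs A v = {w. (v, w) \<in> A}"

definition induced_arcs :: "('a \<times> 'a) set \<Rightarrow> 'a set \<Rightarrow> ('a \<times> 'a) set" where
  "induced_arcs A S = A \<inter> (S \<times> S)"

definition di_simplicial :: "('a \<times> 'a) set \<Rightarrow> 'a \<Rightarrow> bool" where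
  "di_simplicial A v \<longleftrightarrow>
     (\<forall>u \<in> in_nbrs A v. \<forall>w \<in> out_nbrs A v. u \<noteq> w \<longrightarrow> (u, w) \<in> A)"

definition chordal :: "'a set \<Rightarrow> ('a \<times> 'a) set \<Rightarrow> bool" where
  "chordal V A \<longleftrightarrow>
     (\<forall>S. S \<subseteq> V \<longrightarrow> S \<noteq> {} \<longrightarrow> (\<exists>v \<in> S. di_simplicial (induced_arcs A S) v))"

text \<open>S(D): the symmetric arcs of D (spanning subdigraph, same vertex set).\<close>
definition sym_arcs :: "('a \<times> 'a) set \<Rightarrow> ('a \<times> 'a) set" where
  "sym_arcs A = {(x, y). (x, y) \<in> A \<and> (y, x) \<in> A}"

definition semicomplete_on :: "('a \<times> 'a) set \<Rightarrow> 'a set \<Rightarrow> bool" where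
  "semicomplete_on A X \<longleftrightarrow> (\<forall>x \<in> X. \<forall>y \<in> X. x \<noteq> y \<longrightarrow> (x, y) \<in> A \<or> (y, x) \<in> A)"

definition locally_semicomplete :: "'a set \<Rightarrow> ('a \<times> 'a) set \<Rightarrow> bool" where
  "locally_semicomplete V A \<longleftrightarrow>
     (\<forall>v \<in> V. semicomplete_on A (in_nbrs A v) \<and> semicomplete_on A (out_nbrs A v))"

definition contains_induced :: "'b set \<Rightarrow> ('b \<times> 'b) set \<Rightarrow> 'a set \<Rightarrow> ('a \<times> 'a) set \<Rightarrow> bool" where
  "contains_induced VH AH V A \<longleftrightarrow>
     (\<exists>f. inj_on f VH \<and> f ` VH \<subseteq> V \<and>
          (\<forall>x \<in> VH. \<forall>y \<in> VH. (x, y) \<in> AH \<longleftrightarrow> (f x, f y) \<in> A))"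

text \<open>Directed cycle of length k on {0..<k}: arcs i \<rightarrow> i+1 mod k (non-symmetric for k \<ge> 3).\<close>
definition cycle_arcs :: "nat \<Rightarrow> (nat \<times> nat) set" where
  "cycle_arcs k = {(i, Suc i mod k) | i. i < k}"

definition F_V :: "nat set" where "F_V = {1, 2, 3, 4}"

definition F_a :: "(nat \<times> nat) set" where
  "F_a = {(1,3), (3,1), (2,4), (4,2), (1,2), (2,3), (4,1), (3,4), (4,3)}"

definition F_b :: "(nat \<times> nat) set" where
  "F_b = {(1,3), (3,1), (2,4), (4,2), (1,2), (2,3), (3,4), (4,1)}"

definition F_c :: "(nat \<times> nat) set" where
  "F_c = {(1,3), (3,1), (2,4), (4,2), (1,2), (2,3), (4,3), (4,1)}"

definition F_d_V :: "nat set" where "F_d_V = {1, 2, 3}"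

definition F_d :: "(nat \<times> nat) set" where
  "F_d = {(1,2), (2,3), (3,1)}"

end

theory Submission
  imports Defs
begin

text \<open>
  Write \<open>a \<Rrightarrow> b\<close> for non-symmetric and \<open>a \<sim> b\<close> for symmetric arcs. For sufficiency, excluding
  \<open>F_a\<close>, \<open>F_b\<close>, \<open>F_c\<close> amounts to excluding paths \<open>a \<Rrightarrow> b \<Rrightarrow> c \<Rrightarrow> d\<close> with \<open>a \<sim> c\<close> and \<open>b \<sim> d\<close>, since
  \<open>a\<close> and \<open>d\<close> are then adjacent. Call \<open>v\<close> a mid vertex if \<open>p \<Rrightarrow> v \<Rrightarrow> q\<close> for some non-adjacent
  \<open>p\<close>, \<open>q\<close>. A shortest cycle of \<open>\<Rrightarrow>\<close> is a 4-cycle whose first and third vertices are mid, so \<open>\<Rrightarrow>\<close>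
  is acyclic on the non-mid vertices, and these form a nonempty set closed under \<open>\<sim>\<close>. A candidate,
  i.e. a non-mid vertex that is simplicial in \<open>S(D)\<close>, is di-simplicial unless it starts or ends a
  path \<open>s \<Rrightarrow> x \<Rrightarrow> u\<close> with \<open>s \<sim> u\<close>. If it does, then some such \<open>x\<close> between \<open>s\<close> and \<open>u\<close> is again a
  candidate, by Dirac's argument on chordal graphs. Hence a first candidate ends no such path,
  and a last candidate \<open>s\<close> among those that end none also starts none: otherwise a first
  candidate \<open>x\<close> between \<open>s\<close> and \<open>u\<close> would end none and come after \<open>s\<close>.
\<close>

section \<open>Simplicial vertices of chordal graphs\<close>

lemma di_simplicial_induced_iff:
  assumes "v \<in> W"
  shows "di_simplicial (induced_arcs E W) v \<longleftrightarrow>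
    (\<forall>x\<in>W. \<forall>y\<in>W. (x, v) \<in> E \<longrightarrow> (v, y) \<in> E \<longrightarrow> x \<noteq> y \<longrightarrow> (x, y) \<in> E)"
  using assms by (auto simp: di_simplicial_def induced_arcs_def in_nbrs_def out_nbrs_def)

lemma chordal_subset: "chordal V A \<Longrightarrow> W \<subseteq> V \<Longrightarrow> chordal W A"
  unfolding chordal_def by (meson order_trans)

lemma chordal_nonempty:
  assumes "chordal W E" "W \<noteq> {}"
  obtains v where "v \<in> W" "di_simplicial (induced_arcs E W) v"
  using assms unfolding chordal_def by (meson order_refl)

text \<open>A form of Dirac's theorem that a chordal graph is complete or has two non-adjacent
  simplicial vertices.\<close>

lemma simplicial_outside_clique:
  assumes "finite W" "sym E" "chordal W E" "K \<subset> W"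
    and "\<And>x y. x \<in> K \<Longrightarrow> y \<in> K \<Longrightarrow> x \<noteq> y \<Longrightarrow> (x, y) \<in> E"
  shows "\<exists>v\<in>W - K. di_simplicial (induced_arcs E W) v"
  using assms
proof (induction "card W" arbitrary: W K rule: less_induct)
  case less
  have "W \<noteq> {}" using less.prems(4) by blast
  then obtain v where v: "v \<in> W" "di_simplicial (induced_arcs E W) v"
    using chordal_nonempty less.prems(3) by metis
  note simp_v = v(2)[unfolded di_simplicial_induced_iff[OF v(1)], rule_format]
  show ?case
  proof (cases "v \<in> K")
    case False
    with v show ?thesis by blast
  next
    case True
    \<comment> \<open>Induct with the clique \<open>N\<close> instead of \<open>K - {v}\<close>: a vertex outside \<open>N\<close> is not adjacent to \<open>v\<close>,
      so it stays simplicial when \<open>v\<close> is put back.\<close>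
    define N where "N = {x \<in> W - {v}. (v, x) \<in> E}"
    have KN: "K \<subseteq> insert v N"
      using less.prems(4,5) True by (auto simp: N_def)
    have clique: "(x, y) \<in> E" if "x \<in> N" "y \<in> N" "x \<noteq> y" for x y
      using that simp_v \<open>sym E\<close> by (auto simp: N_def dest: symD)
    show ?thesis
    proof (cases "N = W - {v}")
      case True
      obtain w where w: "w \<in> W - K" using less.prems(4) by blast
      have "(x, y) \<in> E" if "x \<in> W" "y \<in> W" "x \<noteq> y" for x y
        using that clique[of x y] True \<open>sym E\<close> unfolding N_def by (auto dest: symD)
      then show ?thesis using w di_simplicial_induced_iff[of w W E] by blast
    next
      case False
      then have "N \<subset> W - {v}" by (auto simp: N_def)
      moreover have "card (W - {v}) < card W"
        using v less.prems(1) by (intro card_Diff1_less)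
      moreover have "chordal (W - {v}) E" using less.prems(3) chordal_subset by blast
      ultimately obtain x where x: "x \<in> W - {v} - N" "di_simplicial (induced_arcs E (W - {v})) x"
        using less.hyps[of "W - {v}" N] less.prems(1,2) clique by blast
      have "(x, v) \<notin> E" "(v, x) \<notin> E" using x \<open>sym E\<close> by (auto simp: N_def dest: symD)
      with x have "di_simplicial (induced_arcs E W) x"
        using di_simplicial_induced_iff[of x "W - {v}" E] di_simplicial_induced_iff[of x W E] by blast
      then show ?thesis using x KN by blast
    qed
  qed
qed

text \<open>\<open>B\<close> is a union of components of what remains after deleting the closed
  neighbourhoods of \<open>a\<close> and \<open>c\<close>. The induction deletes a simplicial vertex
  \<open>v\<close>; allowing \<open>a = c\<close> lets the edge shrink to a single vertex when
  \<open>v\<close> is one of its ends.\<close>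

lemma simplicial_beyond_edge:
  assumes "finite W" "sym E" "chordal W E" "a \<in> W" "c \<in> W" "a = c \<or> (a, c) \<in> E"
    and "B \<subseteq> W" "B \<noteq> {}"
    and "\<And>b. b \<in> B \<Longrightarrow> b \<noteq> a \<and> b \<noteq> c \<and> (b, a) \<notin> E \<and> (b, c) \<notin> E"
    and "\<And>b y. b \<in> B \<Longrightarrow> y \<in> W \<Longrightarrow> (b, y) \<in> E \<Longrightarrow> y \<in> B \<or> (y, a) \<in> E \<or> (y, c) \<in> E"
  shows "\<exists>b\<in>B. di_simplicial (induced_arcs E W) b"
  using assms
proof (induction "card W" arbitrary: W a c rule: less_induct)
  case less
  have symE: "(x, y) \<in> E \<Longrightarrow> (y, x) \<in> E" for x y using \<open>sym E\<close> by (rule symD)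
  have "W \<noteq> {}" using less.prems(4) by blast
  then obtain v where v: "v \<in> W" "di_simplicial (induced_arcs E W) v"
    using chordal_nonempty less.prems(3) by metis
  note simp_v = v(2)[unfolded di_simplicial_induced_iff[OF v(1)], rule_format]
  have smaller: "card (W - {v}) < card W" "finite (W - {v})" "chordal (W - {v}) E"
    using v less.prems(1,3) chordal_subset[of W E "W - {v}"] card_Diff1_less[of W v] by auto
  have lift: "\<exists>b\<in>B. di_simplicial (induced_arcs E W) b"
    if b: "b \<in> B" "b \<noteq> v" "(b, v) \<notin> E" "di_simplicial (induced_arcs E (W - {v})) b" for b
  proof -
    have "b \<in> W" using b less.prems(7) by blast
    then show ?thesis
      using b symE di_simplicial_induced_iff[of b "W - {v}" E] di_simplicial_induced_iff[of b W E]
      by blast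
  qed
  \<comment> \<open>Here \<open>v\<close> is one end of the edge and \<open>t\<close> the other. As
    \<open>v\<close> is simplicial, its neighbours other than \<open>t\<close> are neighbours of
    \<open>t\<close>, so \<open>t\<close> alone can replace the edge.\<close>
  have contract: ?case
    if "v \<notin> B" "t \<in> W" "t \<noteq> v" "(t, v) \<in> E" "\<And>b. b \<in> B \<Longrightarrow> b \<noteq> v \<and> b \<noteq> t \<and> (b, v) \<notin> E \<and> (b, t) \<notin> E"
      "\<And>b y. b \<in> B \<Longrightarrow> y \<in> W \<Longrightarrow> (b, y) \<in> E \<Longrightarrow> y \<in> B \<or> (y, v) \<in> E \<or> (y, t) \<in> E" for t
  proof -
    have "\<exists>b\<in>B. di_simplicial (induced_arcs E (W - {v})) b"
    proof (rule less.hyps[of _ t t])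
      fix b y assume "b \<in> B" "y \<in> W - {v}" "(b, y) \<in> E"
      then show "y \<in> B \<or> (y, t) \<in> E \<or> (y, t) \<in> E"
        using that simp_v[of y t] symE by blast
    qed (use that smaller less.prems in auto)
    then show ?thesis using lift that by blast
  qed
  consider "v \<in> B" | "v \<notin> B" "v \<noteq> a" "v \<noteq> c" | "v = a" "v \<noteq> c" | "v = c" "v \<noteq> a" | "v = a" "v = c"
    using less.prems(9) by blast
  then show ?case
  proof cases
    case 1
    with v show ?thesis by blast
  next
    case 2
    \<comment> \<open>A neighbour \<open>v\<close> of \<open>b\<close> outside \<open>B\<close> is
      adjacent to \<open>a\<close> or \<open>c\<close>; being simplicial, it would make
      \<open>b\<close> adjacent to that end too.\<close>
    have far: "(b, v) \<notin> E" if "b \<in> B" for b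
    proof
      assume bv: "(b, v) \<in> E"
      then have "(v, a) \<in> E \<or> (v, c) \<in> E" using less.prems(10)[OF that v(1)] 2 by blast
      then show False
        using simp_v[of b a] simp_v[of b c] less.prems(4,5,7) less.prems(9)[OF that] bv that by blast
    qed
    have "\<exists>b\<in>B. di_simplicial (induced_arcs E (W - {v})) b"
    proof (rule less.hyps[of _ a c])
      fix b y assume "b \<in> B" "y \<in> W - {v}" "(b, y) \<in> E"
      then show "y \<in> B \<or> (y, a) \<in> E \<or> (y, c) \<in> E" using less.prems(10) by blast
    qed (use 2 smaller less.prems in auto)
    then show ?thesis using lift far 2 by blast
  next
    case 3
    show ?thesis by (rule contract[of c]) (use 3 less.prems symE in blast)+
  next
    case 4
    show ?thesis by (rule contract[of a]) (use 4 less.prems symE in blast)+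
  next
    case 5
    \<comment> \<open>The closed neighbourhood of the simplicial vertex \<open>a\<close> is a
      clique, and \<open>B \<union> K\<close> contains all neighbours of \<open>B\<close> in
      \<open>W\<close>.\<close>
    define K where "K = insert a {y \<in> W. (y, a) \<in> E}"
    have "\<exists>x\<in>B \<union> K - K. di_simplicial (induced_arcs E (B \<union> K)) x"
    proof (rule simplicial_outside_clique)
      show "finite (B \<union> K)" using less.prems(1,7) by (auto simp: K_def intro: finite_subset)
      show "chordal (B \<union> K) E"
        by (rule chordal_subset[OF less.prems(3)]) (use less.prems in \<open>auto simp: K_def\<close>)
      show "K \<subset> B \<union> K" using less.prems(8,9) 5 by (auto simp: K_def)
      show "(x, y) \<in> E" if "x \<in> K" "y \<in> K" "x \<noteq> y" for x y
        using that simp_v[of x y] symE 5 by (auto simp: K_def)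
    qed (fact less.prems)
    then obtain x where x: "x \<in> B" "di_simplicial (induced_arcs E (B \<union> K)) x" by blast
    have "y \<in> B \<union> K" if "(x, y) \<in> E" "y \<in> W" for y
      using less.prems(10)[OF x(1) that(2,1)] that 5 by (auto simp: K_def)
    moreover have "x \<in> W" using x less.prems(7) by blast
    ultimately show ?thesis
      using x symE di_simplicial_induced_iff[of x "B \<union> K" E] di_simplicial_induced_iff[of x W E]
      by blast
  qed
qed

section \<open>Forbidden configurations of symmetric and non-symmetric arcs\<close>

text \<open>The assumptions pass to induced subdigraphs, and the locale is interpreted in each of
  them, so the goal inside it is a single di-simplicial vertex.\<close>

locale cycle_free_locally_semicomplete =
  fixes V :: "'a set" and A :: "('a \<times> 'a) set"
  assumes digraph: "digraph V A"
    and locally_semicomplete: "locally_semicomplete V A"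
    and chordal_sym: "chordal V (sym_arcs A)"
    and no_cycle: "3 \<le> k \<Longrightarrow> \<not> contains_induced {0..<k} (cycle_arcs k) V A"
    and no_F: "\<not> contains_induced F_V F_a V A" "\<not> contains_induced F_V F_b V A"
      "\<not> contains_induced F_V F_c V A"
begin

definition ns :: "'a \<Rightarrow> 'a \<Rightarrow> bool" (infix "\<Rrightarrow>" 50) where
  "a \<Rrightarrow> b \<longleftrightarrow> (a, b) \<in> A \<and> (b, a) \<notin> A"

definition sy :: "'a \<Rightarrow> 'a \<Rightarrow> bool" (infix "\<sim>" 50) where
  "a \<sim> b \<longleftrightarrow> (a, b) \<in> A \<and> (b, a) \<in> A"

definition adj :: "'a \<Rightarrow> 'a \<Rightarrow> bool" where
  "adj a b \<longleftrightarrow> (a, b) \<in> A \<or> (b, a) \<in> A"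

lemma arc_in: "(a, b) \<in> A \<Longrightarrow> a \<in> V \<and> b \<in> V"
  using digraph by (auto simp: digraph_def)

lemma no_loop: "(a, a) \<notin> A"
  using digraph by (auto simp: digraph_def)

lemma out_adj: "(v, x) \<in> A \<Longrightarrow> (v, y) \<in> A \<Longrightarrow> x \<noteq> y \<Longrightarrow> adj x y"
  using locally_semicomplete arc_in
  unfolding locally_semicomplete_def semicomplete_on_def out_nbrs_def adj_def by blast

lemma in_adj: "(x, v) \<in> A \<Longrightarrow> (y, v) \<in> A \<Longrightarrow> x \<noteq> y \<Longrightarrow> adj x y"
  using locally_semicomplete arc_in
  unfolding locally_semicomplete_def semicomplete_on_def in_nbrs_def adj_def by blast

lemma no_triangle:
  assumes "a \<Rrightarrow> b" "b \<Rrightarrow> c" "c \<Rrightarrow> a"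
  shows False
proof -
  let ?f = "\<lambda>i::nat. if i = 0 then a else if i = 1 then b else c"
  have ne: "a \<noteq> b" "b \<noteq> c" "a \<noteq> c" and inV: "a \<in> V" "b \<in> V" "c \<in> V"
    using assms no_loop arc_in by (auto simp: ns_def)
  note facts = assms[unfolded ns_def] ne ne[symmetric] inV no_loop
  have eq: "{0..<3::nat} = {0, 1, 2}" by auto
  have "cycle_arcs 3 = (\<lambda>i. (i, Suc i mod 3)) ` {0..<3}"
    unfolding cycle_arcs_def by (rule set_eqI) (simp add: image_iff Bex_def conj_commute)
  then have c3: "cycle_arcs 3 = {(0, 1), (1, 2), (2, 0)}"
    by (simp add: eq numeral_2_eq_2)
  have "contains_induced {0..<3} (cycle_arcs 3) V A"
    unfolding contains_induced_def eq c3
    by (rule exI[of _ ?f]) (simp add: facts)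
  with no_cycle[of 3] show False by simp
qed

lemma no_crossed_path:
  assumes "a \<Rrightarrow> b" "b \<Rrightarrow> c" "c \<Rrightarrow> d" "a \<sim> c" "b \<sim> d"
  shows False
proof -
  \<comment> \<open>The vertices \<open>a\<close>, \<open>b\<close>, \<open>c\<close>,
    \<open>d\<close> play 4, 1, 2, 3; the three figures differ only in the arcs between
    \<open>a\<close> and \<open>d\<close>.\<close>
  let ?f = "\<lambda>i::nat. if i = 1 then b else if i = 2 then c else if i = 3 then d else a"
  have ne: "a \<noteq> b" "b \<noteq> c" "c \<noteq> d" "a \<noteq> c" "b \<noteq> d" "a \<noteq> d"
    and inV: "a \<in> V" "b \<in> V" "c \<in> V" "d \<in> V"
    using assms no_loop arc_in by (auto simp: ns_def sy_def)
  note facts = assms[unfolded ns_def sy_def] ne ne[symmetric] inV no_loop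
  have "adj a d" using assms ne out_adj[of c a d] by (auto simp: ns_def sy_def)
  then consider "a \<sim> d" | "d \<Rrightarrow> a" | "a \<Rrightarrow> d" by (auto simp: adj_def ns_def sy_def)
  then show False
  proof cases
    case 1
    have "contains_induced F_V F_a V A"
      unfolding contains_induced_def F_V_def F_a_def
      by (rule exI[of _ ?f]) (simp add: facts 1[unfolded ns_def sy_def])
    with no_F show False by blast
  next
    case 2
    have "contains_induced F_V F_b V A"
      unfolding contains_induced_def F_V_def F_b_def
      by (rule exI[of _ ?f]) (simp add: facts 2[unfolded ns_def sy_def])
    with no_F show False by blast
  next
    case 3
    have "contains_induced F_V F_c V A"
      unfolding contains_induced_def F_V_def F_c_def
      by (rule exI[of _ ?f]) (simp add: facts 3[unfolded ns_def sy_def])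
    with no_F show False by blast
  qed
qed

section \<open>Mid vertices\<close>

definition mid :: "'a \<Rightarrow> bool" where
  "mid v \<longleftrightarrow> (\<exists>p q. p \<Rrightarrow> v \<and> v \<Rrightarrow> q \<and> p \<noteq> q \<and> \<not> adj p q)"

text \<open>Local semicompleteness at \<open>v'\<close> makes \<open>v\<close> adjacent to both
  witnesses \<open>p\<close> and \<open>q\<close>. As these are not adjacent, one must be an
  in-neighbour only and the other an out-neighbour only, possibly in reversed roles.\<close>

lemma mid_sym:
  assumes "v \<sim> v'" "mid v'"
  shows "mid v"
proof -
  obtain p q where pq: "p \<Rrightarrow> v'" "v' \<Rrightarrow> q" "p \<noteq> q" "\<not> adj p q"
    using assms unfolding mid_def by blast
  have "adj v p" "adj v q"
    using assms pq in_adj[of v v' p] out_adj[of v' v q] by (auto simp: ns_def sy_def)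
  moreover have "\<not> ((v, p) \<in> A \<and> (v, q) \<in> A)" "\<not> ((p, v) \<in> A \<and> (q, v) \<in> A)"
    using pq out_adj in_adj by blast+
  ultimately have "p \<Rrightarrow> v \<and> v \<Rrightarrow> q \<or> q \<Rrightarrow> v \<and> v \<Rrightarrow> p"
    unfolding adj_def ns_def by blast
  then show ?thesis using pq unfolding mid_def adj_def by blast
qed

text \<open>Any witnesses for \<open>mid x\<close> also serve for \<open>s\<close> and
  \<open>u\<close>. Both vertices turn out adjacent to \<open>p\<close> and \<open>q\<close>;
  \<open>excl\<close> and the absence of directed triangles fix the directions.\<close>

lemma mid_between_neighbours:
  assumes "s \<Rrightarrow> x" "x \<Rrightarrow> u" "s \<sim> u" "p \<Rrightarrow> x" "x \<Rrightarrow> q" "p \<noteq> q" "\<not> adj p q"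
  shows "p \<Rrightarrow> s \<and> s \<Rrightarrow> q \<and> p \<Rrightarrow> u \<and> u \<Rrightarrow> q"
proof -
  have excl: "\<not> ((v, p) \<in> A \<and> (v, q) \<in> A)" "\<not> ((p, v) \<in> A \<and> (q, v) \<in> A)" for v
    using assms(6,7) out_adj in_adj by blast+
  \<comment> \<open>If \<open>p = s\<close>, then \<open>q\<close> differs from \<open>u\<close>, so
    \<open>u\<close> is adjacent to \<open>q\<close> and symmetrically to \<open>p\<close>, against
    \<open>excl\<close>. The case \<open>q = u\<close> is dual.\<close>
  have "p \<noteq> s \<or> q \<noteq> u" using assms(3,7) by (auto simp: sy_def adj_def)
  then have "p \<noteq> s" "q \<noteq> u"
    using in_adj[of p x s] out_adj[of x q u] excl[of s] excl[of u] assms(1-5)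
    by (auto simp: ns_def sy_def adj_def)
  moreover have "p \<noteq> u" "q \<noteq> s" using assms by (auto simp: ns_def)
  ultimately have ne: "p \<noteq> s" "q \<noteq> u" "p \<noteq> u" "q \<noteq> s" by blast+
  have ps: "adj p s" using assms in_adj[of p x s] ne by (auto simp: ns_def)
  have qu: "adj q u" using assms out_adj[of x q u] ne by (auto simp: ns_def)
  have pu: "adj p u" using ps assms out_adj[of s p u] in_adj[of p s u] ne by (auto simp: ns_def sy_def adj_def)
  have "\<not> u \<Rrightarrow> p" using no_triangle assms by blast
  moreover have "\<not> p \<sim> u" using qu excl unfolding adj_def sy_def by blast
  ultimately have "p \<Rrightarrow> u" using pu unfolding adj_def ns_def sy_def by blast
  then have "u \<Rrightarrow> q" using qu excl[of u] unfolding adj_def ns_def by blast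
  have sq: "adj s q" using assms \<open>u \<Rrightarrow> q\<close> out_adj[of u s q] ne by (auto simp: ns_def sy_def)
  have "\<not> q \<Rrightarrow> s" using no_triangle assms by blast
  then have "(s, q) \<in> A" using sq unfolding adj_def ns_def by blast
  then have "p \<Rrightarrow> s" using ps excl[of s] unfolding adj_def ns_def by blast
  then have "s \<Rrightarrow> q" using sq excl[of s] unfolding adj_def ns_def by blast
  with \<open>p \<Rrightarrow> u\<close> \<open>u \<Rrightarrow> q\<close> \<open>p \<Rrightarrow> s\<close> show ?thesis by blast
qed

lemma mid_between:
  assumes "s \<Rrightarrow> x" "x \<Rrightarrow> u" "s \<sim> u" "mid x"
  shows "mid s"
proof -
  obtain p q where pq: "p \<Rrightarrow> x" "x \<Rrightarrow> q" "p \<noteq> q" "\<not> adj p q"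
    using assms(4) unfolding mid_def by blast
  from mid_between_neighbours[OF assms(1-3) this] pq(3,4) show ?thesis unfolding mid_def by blast
qed

section \<open>Shortest cycles of non-symmetric arcs\<close>

definition arcs_on :: "'a set \<Rightarrow> ('a \<times> 'a) set" where
  "arcs_on U = {(x, y). x \<in> U \<and> y \<in> U \<and> x \<Rrightarrow> y}"

text \<open>In a shortest cycle every chord is symmetric. Without chords the cycle is a forbidden
  induced one; with a chord there is one of length 2, and length 5 or more then leads to a crossed
  path.\<close>

lemma kite_if_cyclic:
  assumes "\<not> acyclic (arcs_on U)"
  obtains a b c d where "{a, b, c, d} \<subseteq> U" "a \<Rrightarrow> b" "b \<Rrightarrow> c" "c \<Rrightarrow> d" "d \<Rrightarrow> a" "a \<sim> c" "b \<noteq> d" "\<not> adj b d"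
proof -
  let ?R = "arcs_on U"
  define k where "k = (LEAST n. 0 < n \<and> (\<exists>x. (x, x) \<in> ?R ^^ n))"
  have "\<exists>n. 0 < n \<and> (\<exists>x. (x, x) \<in> ?R ^^ n)"
    using assms unfolding acyclic_def trancl_power by blast
  from LeastI_ex[OF this] have "0 < k" "\<exists>x. (x, x) \<in> ?R ^^ k" unfolding k_def by blast+
  then obtain x f where f: "f 0 = x" "f k = x" "\<And>i. i < k \<Longrightarrow> (f i, f (Suc i)) \<in> ?R"
    unfolding relpow_fun_conv by blast
  have min: "k \<le> m" if "0 < m" "(y, y) \<in> ?R ^^ m" for m y
    unfolding k_def by (rule Least_le) (use that in blast)
  \<comment> \<open>The periodic extension lets every argument start at an arbitrary vertex of the
    cycle.\<close>
  define g where "g i = f (i mod k)" for i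
  have per: "g (i + k) = g i" for i by (simp add: g_def)
  have step: "(g i, g (Suc i)) \<in> ?R" for i
    using f(3)[of "i mod k"] \<open>0 < k\<close> f(1,2) by (auto simp: g_def mod_Suc)
  have walk: "(g i, g (i + d)) \<in> ?R ^^ d" for i d
    by (induction d) (use step in \<open>auto intro: relcompI\<close>)
  have gU: "g i \<in> U" and gns: "g i \<Rrightarrow> g (Suc i)" for i using step[of i] by (auto simp: arcs_on_def)
  have k3: "3 \<le> k"
  proof (rule ccontr)
    assume "\<not> 3 \<le> k"
    then consider "k = 1" | "k = 2" using \<open>0 < k\<close> by linarith
    then show False
    proof cases
      case 1
      then show ?thesis using gns[of 0] per[of 0] no_loop by (auto simp: ns_def)
    next
      case 2
      then show ?thesis using gns[of 0] gns[of 1] per[of 0] by (auto simp: ns_def numeral_2_eq_2)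
    qed
  qed
  have inj: "g i \<noteq> g (i + d)" if "0 < d" "d < k" for i d
    using min[of d "g i"] walk[of i d] that by auto
  \<comment> \<open>Such a chord and the rest of the cycle would form a closed walk of length
    \<open>k - d + 1\<close>, less than \<open>k\<close>.\<close>
  have no_short: "\<not> g i \<Rrightarrow> g (i + d)" if "2 \<le> d" "d < k" for i d
  proof
    assume "g i \<Rrightarrow> g (i + d)"
    then have "(g i, g (i + d)) \<in> ?R" using gU by (simp add: arcs_on_def)
    moreover have "(g (i + d), g i) \<in> ?R ^^ (k - d)"
      using walk[of "i + d" "k - d"] per[of i] that by simp
    ultimately have "(g (i + d), g (i + d)) \<in> ?R ^^ Suc (k - d)" by auto
    from min[OF _ this] show False using that by simp
  qed
  \<comment> \<open>By periodicity a backward chord is a forward chord of length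
    \<open>k - d\<close> starting at \<open>i + d\<close>.\<close>
  have no_short': "\<not> g (i + d) \<Rrightarrow> g i" if "0 < d" "d \<le> k - 2" for i d
    using no_short[of "k - d" "i + d"] per[of i] that k3 by simp
  have chord_sym: "g i \<sim> g (i + d)" if "adj (g i) (g (i + d))" "2 \<le> d" "d \<le> k - 2" for i d
  proof -
    have "d < k" "0 < d" using that k3 by linarith+
    with no_short[of d i] no_short'[of d i] that show ?thesis
      unfolding adj_def ns_def sy_def by blast
  qed
  show thesis
  proof (cases "\<exists>i d. 2 \<le> d \<and> d \<le> k - 2 \<and> adj (g i) (g (i + d))")
    case False
    \<comment> \<open>The excluded pair \<open>0\<close>, \<open>k - 1\<close> is joined by the
      closing arc of the cycle.\<close>
    have nonadj: "(g x, g y) \<notin> A \<and> (g y, g x) \<notin> A" if "x + 2 \<le> y" "y < k" "x \<noteq> 0 \<or> y \<noteq> k - 1" for x y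
    proof -
      have "\<not> adj (g x) (g (x + (y - x)))" 
      proof
        have "2 \<le> y - x" "y - x \<le> k - 2" using that by linarith+
        moreover assume "adj (g x) (g (x + (y - x)))"
        ultimately show False using False by blast
      qed
      then show ?thesis using that by (simp add: adj_def)
    qed
    have cyc: "(x, y) \<in> cycle_arcs k \<longleftrightarrow> y = Suc x \<or> x = k - 1 \<and> y = 0" if "x < k" "y < k" for x y
      using that k3 by (auto simp: cycle_arcs_def mod_Suc)
    have close: "g (k - 1) \<Rrightarrow> g 0" using gns[of "k - 1"] per[of 0] k3 by simp
    have "(x, y) \<in> cycle_arcs k \<longleftrightarrow> (g x, g y) \<in> A" if "x < k" "y < k" for x y
    proof -
      consider "x = y" | "y = Suc x" | "x = Suc y" | "x + 2 \<le> y" | "y + 2 \<le> x" by linarith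
      then show ?thesis
      proof cases
        case 4
        show ?thesis
          using cyc[OF that] nonadj[of x y] that 4 close k3 by (cases "x = 0 \<and> y = k - 1") (auto simp: ns_def)
      next
        case 5
        show ?thesis
          using cyc[OF that] nonadj[of y x] that 5 close k3 by (cases "y = 0 \<and> x = k - 1") (auto simp: ns_def)
      qed (use cyc[OF that] that k3 gns[of x] gns[of y] no_loop in \<open>auto simp: ns_def\<close>)
    qed
    moreover have "inj_on g {0..<k}"
    proof (rule linorder_inj_onI)
      fix x y assume "x < y" "x \<in> {0..<k}" "y \<in> {0..<k}"
      then show "g x \<noteq> g y" using inj[of "y - x" x] by auto
    qed auto
    moreover have "g ` {0..<k} \<subseteq> V" using gns arc_in unfolding ns_def by blast
    ultimately have "contains_induced {0..<k} (cycle_arcs k) V A"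
      unfolding contains_induced_def by (intro exI[of _ g]) auto
    with no_cycle k3 show thesis by blast
  next
    case True
    then obtain i d where id: "2 \<le> d" "d \<le> k - 2" "adj (g i) (g (i + d))" by blast
    \<comment> \<open>A chord from \<open>g i\<close> can be shortened by one: \<open>g i\<close>
      and \<open>g (i + n)\<close> are both in-neighbours of \<open>g (i + n + 1)\<close>, hence
      adjacent.\<close>
    have "g i \<sim> g (i + 2)" using id
    proof (induction d rule: dec_induct)
      case base
      then show ?case using chord_sym by blast
    next
      case (step n)
      have "g i \<sim> g (Suc (i + n))" using chord_sym[of i "Suc n"] step by simp
      then have "adj (g i) (g (i + n))"
        using in_adj[of "g i" "g (Suc (i + n))" "g (i + n)"] gns[of "i + n"] inj[of n i] step
        by (auto simp: ns_def sy_def)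
      then show ?case using step by auto
    qed
    then have g02: "g i \<sim> g (Suc (Suc i))" by simp
    have not13: "\<not> g (Suc i) \<sim> g (Suc (Suc (Suc i)))"
      using no_crossed_path gns g02 by blast
    show thesis
    proof (cases "k = 4")
      case True
      have per4: "g (Suc (Suc (Suc (Suc i)))) = g i" using per[of i] True by (simp add: numeral_eq_Suc)
      show thesis
      proof (rule that[of "g i" "g (Suc i)" "g (Suc (Suc i))" "g (Suc (Suc (Suc i)))"])
        show "g (Suc (Suc (Suc i))) \<Rrightarrow> g i" using gns[of "Suc (Suc (Suc i))"] per4 by simp
        show "g (Suc i) \<noteq> g (Suc (Suc (Suc i)))" using inj[of 2 "Suc i"] True by simp
        show "\<not> adj (g (Suc i)) (g (Suc (Suc (Suc i))))"
          using chord_sym[of "Suc i" 2] not13 True by auto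
      qed (use gU gns g02 in auto)
    next
      case False
      then have "5 \<le> k" using id k3 by linarith
      \<comment> \<open>Common in-neighbour \<open>g (i + 2)\<close> gives the chord from
        \<open>g i\<close> to \<open>g (i + 3)\<close>, which is symmetric as
        \<open>3 \<le> k - 2\<close>; then common in-neighbour \<open>g i\<close> gives the chord
        denied by \<open>not13\<close>.\<close>
      have "adj (g i) (g (i + 3))"
        using out_adj[of "g (Suc (Suc i))" "g i" "g (i + 3)"] g02 gns[of "Suc (Suc i)"] inj[of 3 i] \<open>5 \<le> k\<close>
        by (auto simp: ns_def sy_def numeral_eq_Suc)
      then have "g i \<sim> g (i + 3)" using chord_sym[of i 3] \<open>5 \<le> k\<close> by simp
      then have "adj (g (Suc i)) (g (Suc i + 2))"
        using out_adj[of "g i" "g (Suc i)" "g (i + 3)"] gns[of i] inj[of 2 "Suc i"] \<open>5 \<le> k\<close>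
        by (auto simp: ns_def sy_def numeral_eq_Suc)
      moreover have "2 \<le> k - 2" using \<open>5 \<le> k\<close> by linarith
      ultimately have "g (Suc i) \<sim> g (Suc i + 2)" by (intro chord_sym) auto
      then show thesis using not13 by simp
    qed
  qed
qed

lemma acyclic_not_mid: "acyclic (arcs_on {v. \<not> mid v})"
proof (rule ccontr)
  assume "\<not> ?thesis"
  then obtain a b c d where k: "{a, b, c, d} \<subseteq> {v. \<not> mid v}" "a \<Rrightarrow> b" "b \<Rrightarrow> c" "c \<Rrightarrow> d"
    "d \<Rrightarrow> a" "a \<sim> c" "b \<noteq> d" "\<not> adj b d"
    by (rule kite_if_cyclic)
  then have "\<not> mid a" "\<not> adj d b" by (auto simp: adj_def)
  with k show False unfolding mid_def by blast
qed

lemma finite_arcs_on: "finite (arcs_on U)"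
proof (rule finite_subset)
  show "arcs_on U \<subseteq> V \<times> V" using arc_in by (auto simp: arcs_on_def ns_def)
  show "finite (V \<times> V)" using digraph by (simp add: digraph_def)
qed

text \<open>In the acyclic case a source works. Otherwise \<open>b\<close> of a kite works: a
  witness \<open>p\<close> of \<open>mid b\<close> would satisfy \<open>p \<Rrightarrow> a\<close>
  and \<open>p \<Rrightarrow> c\<close>, which forces \<open>d \<Rrightarrow> p\<close> and the
  triangle \<open>p\<close>, \<open>c\<close>, \<open>d\<close>.\<close>

lemma exists_not_mid:
  assumes "V \<noteq> {}"
  shows "\<exists>v\<in>V. \<not> mid v"
proof (cases "acyclic (arcs_on V)")
  case True
  then have "wf (arcs_on V)" using finite_acyclic_wf finite_arcs_on by blast
  moreover obtain v where "v \<in> V" using assms by blast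
  ultimately obtain r where r: "r \<in> V" "\<And>y. (y, r) \<in> arcs_on V \<Longrightarrow> y \<notin> V"
    unfolding wf_eq_minimal by metis
  have "\<not> y \<Rrightarrow> r" for y using r(2)[of y] r(1) arc_in[of y r] unfolding arcs_on_def ns_def by blast
  then show ?thesis using r unfolding mid_def by blast
next
  case False
  then obtain a b c d where k: "{a, b, c, d} \<subseteq> V" "a \<Rrightarrow> b" "b \<Rrightarrow> c" "c \<Rrightarrow> d" "d \<Rrightarrow> a" "a \<sim> c"
    "b \<noteq> d" "\<not> adj b d"
    by (rule kite_if_cyclic)
  have "\<not> mid b"
  proof
    assume "mid b"
    then obtain p q where pq: "p \<Rrightarrow> b" "b \<Rrightarrow> q" "p \<noteq> q" "\<not> adj p q" unfolding mid_def by blast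
    have "p \<Rrightarrow> a" "p \<Rrightarrow> c" using mid_between_neighbours[OF k(2,3,6) pq] by blast+
    have "d \<noteq> p" using k pq unfolding adj_def ns_def by blast
    then have "adj d p" using in_adj[of d a p] k \<open>p \<Rrightarrow> a\<close> unfolding ns_def by blast
    moreover have "(p, d) \<notin> A" using out_adj[of p b d] k pq unfolding ns_def by blast
    ultimately have "d \<Rrightarrow> p" unfolding adj_def ns_def by blast
    then show False using no_triangle k \<open>p \<Rrightarrow> c\<close> by blast
  qed
  then show ?thesis using k by blast
qed

section \<open>Candidates\<close>

definition simplicial :: "'a \<Rightarrow> bool" where
  "simplicial v \<longleftrightarrow> (\<forall>x y. x \<sim> v \<longrightarrow> v \<sim> y \<longrightarrow> x \<noteq> y \<longrightarrow> x \<sim> y)"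

lemma sym_arcs_iff: "(x, y) \<in> sym_arcs A \<longleftrightarrow> x \<sim> y"
  by (simp add: sym_arcs_def sy_def)

lemma sy_commute: "x \<sim> y \<longleftrightarrow> y \<sim> x"
  by (auto simp: sy_def)

definition candidate :: "'a \<Rightarrow> bool" where
  "candidate v \<longleftrightarrow> v \<in> V \<and> simplicial v \<and> \<not> mid v"

text \<open>The set of non-mid vertices is closed under \<open>\<sim>\<close>, so a vertex
  simplicial within it is simplicial in all of \<open>S(D)\<close>.\<close>

lemma exists_candidate:
  assumes "V \<noteq> {}"
  shows "\<exists>v. candidate v"
proof -
  let ?N = "{v \<in> V. \<not> mid v}"
  have "?N \<noteq> {}" "?N \<subseteq> V" using exists_not_mid assms by auto
  then obtain v where v: "v \<in> ?N" "di_simplicial (induced_arcs (sym_arcs A) ?N) v"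
    using chordal_nonempty chordal_subset[OF chordal_sym] by metis
  have closed: "x \<in> ?N" if "x \<sim> v" for x
    using that v(1) mid_sym[of v x] arc_in by (auto simp: sy_def)
  have "simplicial v"
    unfolding simplicial_def
  proof (intro allI impI)
    fix x y assume "x \<sim> v" "v \<sim> y" "x \<noteq> y"
    moreover from this have "x \<in> ?N" "y \<in> ?N" using closed[of x] closed[of y] sy_commute by blast+
    ultimately show "x \<sim> y"
      using v(2) unfolding di_simplicial_induced_iff[OF v(1)] sym_arcs_iff by blast
  qed
  then show ?thesis using v(1) by (auto simp: candidate_def)
qed

text \<open>Apply \<open>simplicial_beyond_edge\<close> to \<open>S(D)\<close>, the edge
  \<open>su\<close> and the set \<open>?B\<close> of all vertices between \<open>s\<close> and
  \<open>u\<close>; \<open>mid_between\<close> keeps the result non-mid.\<close>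

lemma candidate_between:
  assumes "s \<Rrightarrow> x" "x \<Rrightarrow> u" "s \<sim> u" "\<not> mid s"
  obtains z where "s \<Rrightarrow> z" "z \<Rrightarrow> u" "candidate z"
proof -
  let ?B = "{z. s \<Rrightarrow> z \<and> z \<Rrightarrow> u}"
  have "\<exists>z\<in>?B. di_simplicial (induced_arcs (sym_arcs A) V) z"
  proof (rule simplicial_beyond_edge[where a = s and c = u])
    show "finite V" using digraph by (simp add: digraph_def)
    show "sym (sym_arcs A)" by (auto simp: sym_def sym_arcs_def)
    show "s \<in> V" "u \<in> V" using assms arc_in by (auto simp: ns_def)
    show "s = u \<or> (s, u) \<in> sym_arcs A" using assms by (simp add: sym_arcs_iff)
    show "?B \<subseteq> V" using arc_in by (auto simp: ns_def)
    show "?B \<noteq> {}" using assms by blast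
    show "b \<noteq> s \<and> b \<noteq> u \<and> (b, s) \<notin> sym_arcs A \<and> (b, u) \<notin> sym_arcs A" if "b \<in> ?B" for b
      using that no_loop by (auto simp: sym_arcs_iff sy_def ns_def)
    show "y \<in> ?B \<or> (y, s) \<in> sym_arcs A \<or> (y, u) \<in> sym_arcs A"
      if "b \<in> ?B" "(b, y) \<in> sym_arcs A" for b y
    proof -
      have b: "s \<Rrightarrow> b" "b \<Rrightarrow> u" "b \<sim> y" using that by (auto simp: sym_arcs_iff)
      then have "y \<noteq> s" "y \<noteq> u" by (auto simp: ns_def sy_def)
      then have "adj y s" "adj y u"
        using b in_adj[of y b s] out_adj[of b y u] by (auto simp: ns_def sy_def)
      \<comment> \<open>Either arc would extend \<open>s\<close>, \<open>b\<close>, \<open>u\<close>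
        to a crossed path. With these directions excluded, \<open>y\<close> is between
        \<open>s\<close> and \<open>u\<close> or symmetrically adjacent to one of them.\<close>
      moreover have "\<not> y \<Rrightarrow> s" "\<not> u \<Rrightarrow> y"
        using no_crossed_path[of y s b u] no_crossed_path[of s b u y] b assms sy_commute by blast+
      ultimately show ?thesis by (auto simp: adj_def ns_def sy_def sym_arcs_iff)
    qed
  qed (fact chordal_sym)
  then obtain z where z: "s \<Rrightarrow> z" "z \<Rrightarrow> u" "di_simplicial (induced_arcs (sym_arcs A) V) z" by blast
  have zV: "z \<in> V" using z arc_in by (auto simp: ns_def)
  have "simplicial z"
    unfolding simplicial_def
  proof (intro allI impI)
    fix x y assume "x \<sim> z" "z \<sim> y" "x \<noteq> y"
    moreover from this have "x \<in> V" "y \<in> V" using arc_in unfolding sy_def by blast+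
    ultimately show "x \<sim> y"
      using z(3) unfolding di_simplicial_induced_iff[OF zV] sym_arcs_iff by blast
  qed
  moreover have "\<not> mid z" using mid_between[OF z(1,2) assms(3)] assms(4) by blast
  ultimately show thesis using that z zV by (auto simp: candidate_def)
qed

section \<open>Extremal candidates are di-simplicial\<close>

definition is_end :: "'a \<Rightarrow> bool" where
  "is_end v \<longleftrightarrow> (\<exists>w z. w \<Rrightarrow> z \<and> z \<Rrightarrow> v \<and> w \<sim> v)"

lemma is_end_candidate:
  assumes "is_end v" "candidate v"
  obtains w z where "w \<Rrightarrow> z" "z \<Rrightarrow> v" "w \<sim> v" "candidate z"
proof -
  obtain w z where wz: "w \<Rrightarrow> z" "z \<Rrightarrow> v" "w \<sim> v" using assms unfolding is_end_def by blast
  have "\<not> mid w"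
    using mid_sym[of v w] wz(3) assms(2) unfolding sy_commute[of v] candidate_def by blast
  with wz show thesis using that candidate_between by metis
qed

lemma wf_not_mid: "wf (arcs_on {v. \<not> mid v})" "wf ((arcs_on {v. \<not> mid v})\<inverse>)"
  using acyclic_not_mid finite_arcs_on finite_acyclic_wf finite_acyclic_wf_converse by blast+

lemma minimal_candidate:
  assumes "P x" "\<And>x. P x \<Longrightarrow> candidate x"
  shows "\<exists>m. P m \<and> (\<forall>y. P y \<longrightarrow> \<not> y \<Rrightarrow> m)"
proof -
  obtain m where "m \<in> {x. P x}" "\<And>y. (y, m) \<in> arcs_on {v. \<not> mid v} \<Longrightarrow> y \<notin> {x. P x}"
    using wf_not_mid(1)[unfolded wf_eq_minimal, rule_format, of x "{x. P x}"] assms(1) by auto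
  then show ?thesis using assms(2) unfolding arcs_on_def candidate_def by blast
qed

lemma maximal_candidate:
  assumes "P x" "\<And>x. P x \<Longrightarrow> candidate x"
  shows "\<exists>m. P m \<and> (\<forall>y. P y \<longrightarrow> \<not> m \<Rrightarrow> y)"
proof -
  obtain m where "m \<in> {x. P x}" "\<And>y. (y, m) \<in> (arcs_on {v. \<not> mid v})\<inverse> \<Longrightarrow> y \<notin> {x. P x}"
    using wf_not_mid(2)[unfolded wf_eq_minimal, rule_format, of x "{x. P x}"] assms(1) by auto
  then show ?thesis using assms(2) unfolding arcs_on_def candidate_def by blast
qed

text \<open>Take \<open>x\<close> minimal among the candidates between \<open>s\<close> and
  \<open>u\<close>. By maximality of \<open>s\<close> it ends a path \<open>w\<close>,
  \<open>z\<close>, \<open>x\<close>, and each possible direction between \<open>s\<close> and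
  \<open>z\<close> is contradictory.\<close>

lemma no_start:
  assumes s: "candidate s" "\<not> is_end s"
    and max: "\<And>y. candidate y \<Longrightarrow> \<not> is_end y \<Longrightarrow> \<not> s \<Rrightarrow> y"
    and su: "s \<Rrightarrow> x0" "x0 \<Rrightarrow> u" "s \<sim> u"
  shows False
proof -
  have "\<not> mid s" using s(1) unfolding candidate_def by blast
  then obtain x1 where "s \<Rrightarrow> x1" "x1 \<Rrightarrow> u" "candidate x1"
    using candidate_between su by metis
  then have "\<exists>x. (candidate x \<and> s \<Rrightarrow> x \<and> x \<Rrightarrow> u) \<and> (\<forall>y. candidate y \<and> s \<Rrightarrow> y \<and> y \<Rrightarrow> u \<longrightarrow> \<not> y \<Rrightarrow> x)"
    by (intro minimal_candidate) auto
  then obtain x where x: "candidate x" "s \<Rrightarrow> x" "x \<Rrightarrow> u"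
    and min: "\<And>y. candidate y \<Longrightarrow> s \<Rrightarrow> y \<Longrightarrow> y \<Rrightarrow> u \<Longrightarrow> \<not> y \<Rrightarrow> x"
    by blast
  have "is_end x" using max x by blast
  then obtain w z where wz: "w \<Rrightarrow> z" "z \<Rrightarrow> x" "w \<sim> x" "candidate z"
    using is_end_candidate x(1) by metis
  have zu: "\<not> z \<sim> u" using no_crossed_path[OF wz(1,2) x(3) wz(3)] by blast
  have "s \<noteq> z" using zu su(3) by blast
  have "\<not> s \<sim> z"
  proof
    assume "s \<sim> z"
    then have "z \<sim> s" by (simp add: sy_commute)
    moreover have "z \<noteq> u" using wz x by (auto simp: ns_def)
    ultimately show False using s(1) su(3) zu unfolding candidate_def simplicial_def by blast
  qed
  moreover have "adj s z" using in_adj[of s x z] x wz \<open>s \<noteq> z\<close> by (auto simp: ns_def)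
  ultimately consider "s \<Rrightarrow> z" | "z \<Rrightarrow> s" unfolding adj_def ns_def sy_def by blast
  then show False
  proof cases
    \<comment> \<open>Now \<open>z\<close> is itself a candidate between \<open>s\<close> and
      \<open>u\<close> and precedes \<open>x\<close>, against minimality.\<close>
    case 1
    have "z \<noteq> u" using wz x by (auto simp: ns_def)
    then have "adj z u" using out_adj[of s z u] 1 su by (auto simp: ns_def sy_def)
    moreover have "\<not> u \<Rrightarrow> z" using no_triangle[OF wz(2) x(3)] by blast
    ultimately have "z \<Rrightarrow> u" using zu unfolding adj_def ns_def sy_def by blast
    then show False using min wz 1 by blast
  next
    \<comment> \<open>Absence of triangles and \<open>\<not> is_end s\<close> leave only
      \<open>w \<Rrightarrow> s\<close>, so \<open>w\<close>, \<open>s\<close>, \<open>x\<close>,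
      \<open>u\<close> is a crossed path.\<close>
    case 2
    have "s \<noteq> w" using wz 2 by (auto simp: ns_def)
    then have "adj s w" using in_adj[of s x w] x wz by (auto simp: ns_def sy_def)
    moreover have "\<not> s \<Rrightarrow> w" using no_triangle[OF wz(1) 2] by blast
    moreover have "\<not> w \<sim> s" using s(2) wz 2 unfolding is_end_def by blast
    ultimately have "w \<Rrightarrow> s" unfolding adj_def ns_def sy_def by blast
    from no_crossed_path[OF this x(2,3) wz(3) su(3)] show False .
  qed
qed

text \<open>A missing arc \<open>uw\<close> is excluded according to the types of \<open>uv\<close>
  and \<open>vw\<close>: by simpliciality if both are symmetric, by the start or end condition if
  exactly one is, and by \<open>\<not> mid v\<close> with \<open>no_triangle\<close> if neither
  is.\<close>

lemma di_simplicialI: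
  assumes "candidate v" "\<not> is_end v" "\<And>x u. v \<Rrightarrow> x \<Longrightarrow> x \<Rrightarrow> u \<Longrightarrow> \<not> v \<sim> u"
  shows "di_simplicial A v"
  unfolding di_simplicial_def in_nbrs_def out_nbrs_def
proof (intro ballI impI, unfold mem_Collect_eq, rule ccontr)
  fix u w assume uw: "(u, v) \<in> A" "(v, w) \<in> A" "u \<noteq> w" "(u, w) \<notin> A"
  consider "u \<sim> v" "v \<sim> w" | "u \<sim> v" "v \<Rrightarrow> w" | "u \<Rrightarrow> v" "v \<sim> w" | "u \<Rrightarrow> v" "v \<Rrightarrow> w"
    using uw by (auto simp: ns_def sy_def)
  then show False
  proof cases
    case 1
    then show ?thesis using assms(1) uw unfolding candidate_def simplicial_def sy_def by blast
  next
    case 2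
    then have "w \<Rrightarrow> u" using out_adj[of v u w] uw by (auto simp: ns_def sy_def adj_def)
    then show ?thesis using assms(3)[of w u] 2 sy_commute by blast
  next
    case 3
    then have "w \<Rrightarrow> u" using in_adj[of u v w] uw by (auto simp: ns_def sy_def adj_def)
    then show ?thesis using assms(2) 3 sy_commute unfolding is_end_def by blast
  next
    case 4
    have "adj u w" using assms(1) 4 uw unfolding candidate_def mid_def by blast
    then have "w \<Rrightarrow> u" using uw unfolding adj_def ns_def by blast
    then show ?thesis using 4 no_triangle by blast
  qed
qed

lemma exists_di_simplicial:
  assumes "V \<noteq> {}"
  shows "\<exists>v\<in>V. di_simplicial A v"
proof -
  obtain v where "candidate v" using exists_candidate assms by blast
  then obtain b where b: "candidate b" "\<And>y. candidate y \<Longrightarrow> \<not> y \<Rrightarrow> b"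
    using minimal_candidate[of candidate v] by blast
  \<comment> \<open>The middle vertex of a path ending in \<open>b\<close> could be taken to be a
    candidate preceding \<open>b\<close>.\<close>
  then have "\<not> is_end b" using is_end_candidate by metis
  with b(1) have "\<exists>s. (candidate s \<and> \<not> is_end s) \<and> (\<forall>y. candidate y \<and> \<not> is_end y \<longrightarrow> \<not> s \<Rrightarrow> y)"
    by (intro maximal_candidate) auto
  then obtain s where s: "candidate s" "\<not> is_end s"
    and "\<And>y. candidate y \<Longrightarrow> \<not> is_end y \<Longrightarrow> \<not> s \<Rrightarrow> y"
    by blast
  then have "di_simplicial A s" using di_simplicialI[of s] no_start[of s] by blast
  then show ?thesis using s unfolding candidate_def by blast
qed

end

section \<open>Heredity, necessity and the equivalence\<close>

lemma contains_induced_subset: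
  assumes "contains_induced VH AH S (induced_arcs A S)" "S \<subseteq> V"
  shows "contains_induced VH AH V A"
proof -
  obtain f where f: "inj_on f VH" "f ` VH \<subseteq> S"
    "\<forall>x\<in>VH. \<forall>y\<in>VH. (x, y) \<in> AH \<longleftrightarrow> (f x, f y) \<in> induced_arcs A S"
    using assms(1) unfolding contains_induced_def by blast
  then have "\<forall>x\<in>VH. \<forall>y\<in>VH. (x, y) \<in> AH \<longleftrightarrow> (f x, f y) \<in> A"
    unfolding induced_arcs_def by blast
  with f assms(2) show ?thesis unfolding contains_induced_def by blast
qed

text \<open>The same vertex works: for symmetric neighbours \<open>x\<close> and \<open>y\<close>,
  di-simpliciality applies in both orders.\<close>

lemma chordal_sym_arcs:
  assumes "chordal V A"
  shows "chordal V (sym_arcs A)"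
  unfolding chordal_def
proof (intro allI impI)
  fix S assume "S \<subseteq> V" "S \<noteq> {}"
  then obtain v where "v \<in> S" "di_simplicial (induced_arcs A S) v"
    using assms unfolding chordal_def by blast
  then show "\<exists>v\<in>S. di_simplicial (induced_arcs (sym_arcs A) S) v"
    by (intro bexI[of _ v]) (auto simp: di_simplicial_induced_iff sym_arcs_def)
qed

text \<open>The third premise says that the pattern has no di-simplicial vertex, whereas chordality
  provides one in its image.\<close>

lemma not_contains_induced_if_chordal:
  assumes "chordal V A" "VH \<noteq> {}"
    and "\<And>v. v \<in> VH \<Longrightarrow> \<exists>x\<in>VH. \<exists>y\<in>VH. (x, v) \<in> AH \<and> (v, y) \<in> AH \<and> x \<noteq> y \<and> (x, y) \<notin> AH"
  shows "\<not> contains_induced VH AH V A"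
proof
  assume "contains_induced VH AH V A"
  then obtain f where f: "inj_on f VH" "f ` VH \<subseteq> V"
    "\<forall>x\<in>VH. \<forall>y\<in>VH. (x, y) \<in> AH \<longleftrightarrow> (f x, f y) \<in> A"
    unfolding contains_induced_def by auto
  have "f ` VH \<noteq> {}" using assms(2) by simp
  then obtain v where v: "v \<in> VH" "di_simplicial (induced_arcs A (f ` VH)) (f v)"
    using chordal_nonempty[OF chordal_subset[OF assms(1) f(2)]] by blast
  obtain x y where xy: "x \<in> VH" "y \<in> VH" "(x, v) \<in> AH" "(v, y) \<in> AH" "x \<noteq> y" "(x, y) \<notin> AH"
    using assms(3)[OF v(1)] by blast
  then have "(f x, f v) \<in> A" "(f v, f y) \<in> A" "(f x, f y) \<notin> A" "f x \<noteq> f y"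
    using f v(1) by (auto dest: inj_onD)
  then show False
    using v xy(1,2) di_simplicial_induced_iff[of "f v" "f ` VH" A] by blast
qed

theorem theorem2p4:
  fixes V :: "'a set" and A :: "('a \<times> 'a) set"
  assumes "digraph V A" and "locally_semicomplete V A"
  shows "chordal V A \<longleftrightarrow>
           chordal V (sym_arcs A) \<and>
           \<not> (\<exists>k \<ge> 3. contains_induced {0..<k} (cycle_arcs k) V A) \<and>
           \<not> contains_induced F_V F_a V A \<and>
           \<not> contains_induced F_V F_b V A \<and>
           \<not> contains_induced F_V F_c V A \<and>
           \<not> contains_induced F_d_V F_d V A"
    (is "?L \<longleftrightarrow> ?R")
proof
  assume L: ?L
  note obstr = not_contains_induced_if_chordal[OF L]
  have "\<not> contains_induced {0..<k} (cycle_arcs k) V A" if k: "3 \<le> k" for k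
  proof (rule obstr)
    show "{0..<k} \<noteq> {}" using k by simp
    fix v assume v: "v \<in> {0..<k}"
    \<comment> \<open>Predecessor and successor of \<open>v\<close> on the cycle, distinct because
      \<open>3 \<le> k\<close>.\<close>
    let ?p = "if v = 0 then k - 1 else v - 1" and ?s = "Suc v mod k"
    have arcs: "(x, y) \<in> cycle_arcs k \<longleftrightarrow> x < k \<and> y = Suc x mod k" for x y
      by (auto simp: cycle_arcs_def)
    have "(?p, v) \<in> cycle_arcs k" "(v, ?s) \<in> cycle_arcs k" "?p \<noteq> ?s" "(?p, ?s) \<notin> cycle_arcs k"
      using v k unfolding arcs by (auto simp: mod_Suc)
    moreover have "?p \<in> {0..<k}" "?s \<in> {0..<k}" using v k by auto
    ultimately show "\<exists>x\<in>{0..<k}. \<exists>y\<in>{0..<k}. (x, v) \<in> cycle_arcs k \<and> (v, y) \<in> cycle_arcs k \<and>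
        x \<noteq> y \<and> (x, y) \<notin> cycle_arcs k"
      by blast
  qed
  moreover have "\<not> contains_induced F_V F_a V A"
    by (rule obstr) (auto simp: F_V_def F_a_def)
  moreover have "\<not> contains_induced F_V F_b V A"
    by (rule obstr) (auto simp: F_V_def F_b_def)
  moreover have "\<not> contains_induced F_V F_c V A"
    by (rule obstr) (auto simp: F_V_def F_c_def)
  moreover have "\<not> contains_induced F_d_V F_d V A"
    by (rule obstr) (auto simp: F_d_V_def F_d_def)
  ultimately show ?R using chordal_sym_arcs[OF L] by blast
next
  assume R: ?R
  show ?L
    unfolding chordal_def
  proof (intro allI impI)
    fix S assume S: "S \<subseteq> V" "S \<noteq> {}"
    interpret cycle_free_locally_semicomplete S "induced_arcs A S"
    proof
      show "digraph S (induced_arcs A S)"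
        using assms(1) S by (auto simp: digraph_def induced_arcs_def intro: finite_subset)
      show "locally_semicomplete S (induced_arcs A S)"
        using assms(2) S
        unfolding locally_semicomplete_def semicomplete_on_def induced_arcs_def in_nbrs_def out_nbrs_def
        by blast
      have "induced_arcs (sym_arcs (induced_arcs A S)) T = induced_arcs (sym_arcs A) T" if "T \<subseteq> S" for T
        using that by (auto simp: induced_arcs_def sym_arcs_def)
      moreover have "chordal S (sym_arcs A)" using R S chordal_subset by blast
      ultimately show "chordal S (sym_arcs (induced_arcs A S))"
        unfolding chordal_def by simp
    qed (use R S contains_induced_subset in blast)+
    show "\<exists>v\<in>S. di_simplicial (induced_arcs A S) v"
      using exists_di_simplicial S by blast
  qed
qed

end
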